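(* Let $n\ge1$ and let $p$ be an integer with $n/2<p\le n$. Starting from $n$ closed lockers numbered $1,\dots,n$, let exactly the students $a_1,\dots,a_p$ act, each once. Then the number $\omega$ of open lockers afterwards is $\omega=\theta(p)+\big((n-p)-(\theta(n)-\theta(p))\big)$, where $\theta(m)=\lfloor\sqrt m\rfloor$.
   Context: Locker problem: student $a_i$ acting changes the state (open/closed) of every locker whose number is a multiple of $i$. *)

theory Defs
  imports Complex_Main
begin

text \<open>
  A state of the lockers maps a locker number to \<open>True\<close> if that locker is open.
  Only the values on \<open>{1..n}\<close> are meaningful.
\<close>

type_synonym lockers = "nat \<Rightarrow> bool"

definition all_closed :: lockers where
  "all_closed = (\<lambda>k. False)"

definition act :: "nat \<Rightarrow> nat \<Rightarrow> lockers \<Rightarrow> lockers" where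
  "act n i s = (\<lambda>k. if k \<in> {1..n} \<and> i dvd k then \<not> s k else s k)"

text \<open>The students listed in \<open>xs\<close> act one after the other, from left to right.\<close>

definition final_state :: "nat \<Rightarrow> nat list \<Rightarrow> lockers" where
  "final_state n xs = fold (act n) xs all_closed"

definition num_open :: "nat \<Rightarrow> lockers \<Rightarrow> nat" where
  "num_open n s = card {k \<in> {1..n}. s k}"

definition \<theta> :: "nat \<Rightarrow> int" where
  "\<theta> m = \<lfloor>sqrt (real m)\<rfloor>"

end

theory Submission
  imports Defs
begin

text \<open>
  Locker \<open>k\<close> ends up open iff it has an odd number of divisors among \<open>1, \<dots>, p\<close>. The involution
  \<open>d \<mapsto> k div d\<close> shows that \<open>k\<close> has an odd number of divisors iff it is a square. For \<open>k \<le> p\<close> all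
  divisors are counted; for \<open>p < k \<le> n\<close> exactly the divisor \<open>k\<close> is missing, because a proper
  divisor is at most \<open>k / 2 \<le> n / 2 < p\<close>. Hence the open lockers are the squares up to \<open>p\<close>
  together with the non-squares in \<open>{p<..n}\<close>.
\<close>

text \<open>Each listed divisor of \<open>k\<close> toggles it once, so only the parity of their
  number matters; distinctness makes that number the cardinality of a set. The start state
  \<open>s\<close> is arbitrary because the first student changes it before the induction hypothesis
  applies.\<close>

lemma fold_act_iff:
  assumes "k \<in> {1..n}" and "distinct xs"
  shows "fold (act n) xs s k \<longleftrightarrow> (s k \<noteq> odd (card {i \<in> set xs. i dvd k}))"
  using assms(2)
proof (induction xs arbitrary: s)
  case Nil
  then show ?case by simp
next
  case (Cons x xs)
  have "{i \<in> set (x # xs). i dvd k} =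
      (if x dvd k then insert x {i \<in> set xs. i dvd k} else {i \<in> set xs. i dvd k})"
    by auto
  with Cons assms(1) show ?case
    by (auto simp: act_def)
qed

lemma odd_card_divisors_iff_square:
  fixes k :: nat
  assumes "k > 0"
  shows "odd (card {d. d dvd k}) \<longleftrightarrow> (\<exists>r. k = r\<^sup>2)"
proof -
  \<comment> \<open>Divisors below, at and above the square root of \<open>k\<close>, compared
    through \<open>d * d\<close> to stay within the naturals.\<close>
  let ?L = "{d. d dvd k \<and> d * d < k}" and ?E = "{d. d dvd k \<and> d * d = k}"
    and ?G = "{d. d dvd k \<and> k < d * d}"
  have fin: "finite {d. d dvd k}" using assms by simp
  have finite: "finite ?L" "finite ?E" "finite ?G"
    by (rule finite_subset[OF _ fin]; blast)+
  have cancel: "k div d * d = k" "k div (k div d) = d" "k div d dvd k" if "d dvd k" for d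
    using that assms by auto
  \<comment> \<open>The squares of \<open>d\<close> and \<open>k div d\<close> multiply to
    \<open>k * k\<close>, so if one is below \<open>k\<close>, the other must be above it.\<close>
  have sq: "(k div d) * (k div d) * (d * d) = k * k" if "d dvd k" for d
    using cancel(1)[OF that] by (metis mult.assoc mult.left_commute)
  have less: "k < (k div d) * (k div d)" if "d dvd k" "d * d < k" for d
  proof (rule ccontr)
    assume "\<not> ?thesis"
    then have "(k div d) * (k div d) * (d * d) \<le> k * (d * d)" by simp
    also have "\<dots> < k * k" using that(2) assms by simp
    finally show False using sq[OF that(1)] by simp
  qed
  have greater: "(k div d) * (k div d) < k" if "d dvd k" "k < d * d" for d
  proof (rule ccontr)
    assume "\<not> ?thesis"
    then have "k * (d * d) \<le> (k div d) * (k div d) * (d * d)" by simp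
    moreover have "k * k < k * (d * d)" using that(2) assms by simp
    ultimately show False using sq[OF that(1)] by simp
  qed
  \<comment> \<open>The complementary divisor map is its own inverse and exchanges \<open>?L\<close>
    and \<open>?G\<close>; these cancel modulo 2 and only \<open>?E\<close> decides the
    parity.\<close>
  have "bij_betw (\<lambda>d. k div d) ?L ?G"
    by (rule bij_betw_byWitness[where f' = "\<lambda>d. k div d"]) (use cancel less greater in auto)
  then have LG: "card ?L = card ?G" by (rule bij_betw_same_card)
  have "{d. d dvd k} = (?L \<union> ?G) \<union> ?E" by auto
  then have "card {d. d dvd k} = card ((?L \<union> ?G) \<union> ?E)" by (rule arg_cong)
  also have "\<dots> = card (?L \<union> ?G) + card ?E"
    by (rule card_Un_disjoint) (use finite in auto)
  finally have "card {d. d dvd k} = card (?L \<union> ?G) + card ?E" .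
  moreover have "card (?L \<union> ?G) = card ?L + card ?G"
    by (rule card_Un_disjoint) (use finite in auto)
  ultimately have "card {d. d dvd k} = 2 * card ?L + card ?E"
    using LG by linarith
  then have parity: "odd (card {d. d dvd k}) \<longleftrightarrow> odd (card ?E)"
    by presburger
  show ?thesis
  proof (cases "\<exists>r. k = r\<^sup>2")
    case True
    then obtain r where r: "k = r\<^sup>2" by blast
    then have "d * d = k \<longleftrightarrow> d = r" for d
      by (metis power2_eq_iff_nonneg power2_eq_square zero_le)
    moreover have "r dvd k" using r by (simp add: power2_eq_square)
    ultimately have "?E = {r}" by blast
    with parity True show ?thesis by simp
  next
    case False
    then have "?E = {}" by (auto simp: power2_eq_square)
    with parity False show ?thesis by (metis card.empty even_zero)
  qed
qed

lemma card_squares: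
  "int (card {k \<in> {1..m}. \<exists>r. k = r\<^sup>2}) = \<theta> m"
proof -
  \<comment> \<open>Turns the floor of a real root into a condition on natural squares, so that the
    squares in \<open>{1..m}\<close> are exactly the images of \<open>1, ..., \<theta> m\<close>
    under the injective squaring map.\<close>
  have le_iff: "int r \<le> \<theta> m \<longleftrightarrow> r\<^sup>2 \<le> m" for r
  proof -
    have "int r \<le> \<theta> m \<longleftrightarrow> real r \<le> sqrt (real m)"
      by (simp add: \<theta>_def le_floor_iff)
    also have "\<dots> \<longleftrightarrow> (real r)\<^sup>2 \<le> real m"
      using real_sqrt_le_iff[of "(real r)\<^sup>2" "real m"] by simp
    also have "\<dots> \<longleftrightarrow> r\<^sup>2 \<le> m"
      by (metis of_nat_le_iff of_nat_power)
    finally show ?thesis .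
  qed
  have nonneg: "0 \<le> \<theta> m" by (simp add: \<theta>_def)
  have "{k \<in> {1..m}. \<exists>r. k = r\<^sup>2} = (\<lambda>r. r\<^sup>2) ` {1..nat (\<theta> m)}"
  proof -
    have "r \<in> {1..nat (\<theta> m)} \<longleftrightarrow> r\<^sup>2 \<in> {1..m}" for r :: nat
      using le_iff[of r] nonneg by (simp add: le_nat_iff Suc_le_eq)
    then show ?thesis by blast
  qed
  moreover have "inj_on (\<lambda>r::nat. r\<^sup>2) {1..nat (\<theta> m)}"
    by (rule inj_onI) simp
  ultimately show ?thesis
    using nonneg by (simp add: card_image)
qed

theorem theorem9:
  fixes n p :: nat and students :: "nat list"
  assumes "n \<ge> 1"
    and "real n / 2 < real p" and "p \<le> n"
    and "distinct students" and "set students = {1..p}"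
  shows "int (num_open n (final_state n students)) =
    \<theta> p + ((int n - int p) - (\<theta> n - \<theta> p))"
proof -
  let ?sq = "\<lambda>k::nat. \<exists>r. k = r\<^sup>2"
  have np: "n < 2 * p" using assms(2) by linarith
  have state: "final_state n students k \<longleftrightarrow> odd (card {i \<in> {1..p}. i dvd k})"
    if "k \<in> {1..n}" for k
    using fold_act_iff[OF that assms(4)] assms(5) by (simp add: final_state_def all_closed_def)
  have low: "final_state n students k \<longleftrightarrow> ?sq k" if "k \<in> {1..p}" for k
  proof -
    \<comment> \<open>A divisor of a positive \<open>k\<close> is nonzero and at most
      \<open>k \<le> p\<close>.\<close>
    have "{i \<in> {1..p}. i dvd k} = {d. d dvd k}"
      using that by (auto simp: Suc_le_eq dest: dvd_imp_le intro!: Nat.gr0I)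
    with state[of k] odd_card_divisors_iff_square[of k] that assms(3) show ?thesis by simp
  qed
  have high: "final_state n students k \<longleftrightarrow> \<not> ?sq k" if "k \<in> {p<..n}" for k
  proof -
    have proper: "i \<le> p" if "i dvd k" "i \<noteq> k" for i
    proof -
      from \<open>i dvd k\<close> obtain c where c: "k = i * c" by (rule dvdE)
      \<comment> \<open>A cofactor 0 would give \<open>k = 0\<close>, and 1 would give
        \<open>i = k\<close>. With cofactor at least 2,
        \<open>2 * i \<le> k \<le> n < 2 * p\<close>.\<close>
      with \<open>i \<noteq> k\<close> \<open>k \<in> {p<..n}\<close> have "c \<ge> 2"
        by (cases c; cases "c - 1") auto
      then have "i * 2 \<le> k" unfolding c by (rule mult_le_mono2)
      with \<open>k \<in> {p<..n}\<close> np show ?thesis by simp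
    qed
    have "{d. d dvd k} = insert k {i \<in> {1..p}. i dvd k}"
      using that proper by (auto simp: Suc_le_eq intro!: Nat.gr0I)
    moreover have "k \<notin> {i \<in> {1..p}. i dvd k}" using that by simp
    \<comment> \<open>The one absent divisor flips the parity, hence the negation in
      \<open>high\<close>.\<close>
    ultimately have "card {d. d dvd k} = Suc (card {i \<in> {1..p}. i dvd k})"
      by simp
    with state[of k] odd_card_divisors_iff_square[of k] that show ?thesis by simp
  qed
  let ?S = "{k \<in> {1..p}. ?sq k}" and ?T = "{k \<in> {p<..n}. ?sq k}"
    and ?N = "{k \<in> {p<..n}. \<not> ?sq k}"
  have "{k \<in> {1..n}. final_state n students k} = ?S \<union> ?N"
  proof -
    have "{1..n} = {1..p} \<union> {p<..n}" using assms(3) by auto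
    with low high show ?thesis by blast
  qed
  moreover have "card (?S \<union> ?N) = card ?S + card ?N"
    by (rule card_Un_disjoint) auto
  moreover have "card {k \<in> {1..n}. ?sq k} = card ?S + card ?T"
  proof -
    have "{k \<in> {1..n}. ?sq k} = ?S \<union> ?T" using assms(3) by auto
    moreover have "card (?S \<union> ?T) = card ?S + card ?T"
      by (rule card_Un_disjoint) auto
    ultimately show ?thesis by simp
  qed
  moreover have "n - p = card ?T + card ?N"
  proof -
    have "{p<..n} = ?T \<union> ?N" by auto
    moreover have "card (?T \<union> ?N) = card ?T + card ?N"
      by (rule card_Un_disjoint) auto
    ultimately show ?thesis by (metis card_greaterThanAtMost)
  qed
  \<comment> \<open>Here \<open>card ?S\<close> is \<open>\<theta> p\<close> and
    \<open>card ?T\<close> is \<open>\<theta> n - \<theta> p\<close>, which is removed from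
    \<open>n - p\<close> to leave \<open>card ?N\<close>; \<open>p \<le> n\<close> keeps the natural
    subtraction exact.\<close>
  ultimately show ?thesis
    using card_squares[of p] card_squares[of n] assms(3)
    unfolding num_open_def by simp
qed

end
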